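(* Let $\{\langle X_i,\tau_i\rangle\}_{i\in I}$ be a family of Stone MV-spaces. Then their product $\langle \prod_{i\in I}X_i,\tau_X\rangle$, where $\tau_X$ is the product MV-topology, is a Stone MV-space.
   Context: On $[0,1]$ put $x\oplus y=\min(x+y,1)$, $x\odot y=\max(x+y-1,0)$, $x^*=1-x$, $x\wedge y=\min(x,y)$; these operations and arbitrary joins $\bigvee$ are extended pointwise to $[0,1]^X$. $\mathbf 0,\mathbf 1$ denote the constant functions $0,1$. An MV-topological space is a pair $\langle X,\tau\rangle$ with $X$ a set and $\tau\subseteq[0,1]^X$ such that $\mathbf 0,\mathbf 1\in\tau$, $\tau$ is closed under arbitrary joins, and $o_1\odot o_2,\ o_1\oplus o_2,\ o_1\wedge o_2\in\tau$ for all $o_1,o_2\in\tau$. Elements of $\tau$ are called open, elements of $\{o^*\mid o\in\tau\}$ closed; clopen means open and closed. A base for $\tau$ is a subset $B\subseteq\tau$ such that every element of $\tau$ is a join of elements of $B$. The space is zero-dimensional if it has a base consisting of clopens. It is Hausdorff if for all $x\neq y$ in $X$ there are $o_x,o_y\in\tau$ with $o_x(x)=o_y(y)=1$ and $o_x\wedge o_y=\mathbf 0$. It is compact if for every $\Gamma\subseteq\tau$ with $\bigvee\Gamma=\mathbf 1$ there is a finite family $(\alpha_k)_{k=1}^n$ of elements of $\Gamma$ (repetitions allowed) with $\alpha_1\oplus\cdots\oplus\alpha_n=\mathbf 1$. A Stone MV-space is an MV-topological space which is compact, Hausdorff and zero-dimensional. Product MV-topology: on $X=\prod_{i\in I}X_i$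 with canonical projections $\pi_i$, $\tau_X$ is the MV-topology with subbase $S=\{\alpha\circ\pi_i\mid i\in I,\ \alpha\in\tau_i\}$, i.e. the smallest MV-topology on $X$ containing $S$ (for $I\neq\varnothing$ its elements are exactly the joins of finite combinations of elements of $S$ by $\oplus,\odot,\wedge$). *)

theory Defs
  imports Complex_Main "HOL-Library.FuncSet"
begin

text \<open>
  An element of \<open>[0,1]\<^sup>X\<close> is represented by a function in \<open>X \<rightarrow>\<^sub>E {0..1}\<close>, which is fixed to
  \<^const>\<open>undefined\<close> outside the carrier, so that HOL equality of such functions is equality on
  \<open>X\<close>. All operations below therefore take the carrier as an argument.
\<close>

definition fuzzy_sets :: "'a set \<Rightarrow> ('a \<Rightarrow> real) set" where
  "fuzzy_sets X = X \<rightarrow>\<^sub>E {0..1}"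

definition mv_zero :: "'a set \<Rightarrow> 'a \<Rightarrow> real" where
  "mv_zero X = (\<lambda>x\<in>X. 0)"

definition mv_one :: "'a set \<Rightarrow> 'a \<Rightarrow> real" where
  "mv_one X = (\<lambda>x\<in>X. 1)"

definition mv_oplus :: "'a set \<Rightarrow> ('a \<Rightarrow> real) \<Rightarrow> ('a \<Rightarrow> real) \<Rightarrow> 'a \<Rightarrow> real" where
  "mv_oplus X f g = (\<lambda>x\<in>X. min (f x + g x) 1)"

definition mv_odot :: "'a set \<Rightarrow> ('a \<Rightarrow> real) \<Rightarrow> ('a \<Rightarrow> real) \<Rightarrow> 'a \<Rightarrow> real" where
  "mv_odot X f g = (\<lambda>x\<in>X. max (f x + g x - 1) 0)"

definition mv_meet :: "'a set \<Rightarrow> ('a \<Rightarrow> real) \<Rightarrow> ('a \<Rightarrow> real) \<Rightarrow> 'a \<Rightarrow> real" where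
  "mv_meet X f g = (\<lambda>x\<in>X. min (f x) (g x))"

definition mv_neg :: "'a set \<Rightarrow> ('a \<Rightarrow> real) \<Rightarrow> 'a \<Rightarrow> real" where
  "mv_neg X f = (\<lambda>x\<in>X. 1 - f x)"

text \<open>
  The supremum is meant in the complete lattice \<open>[0,1]\<close>, where the empty supremum is \<open>0\<close>;
  \<^const>\<open>Sup\<close> on the reals is unspecified there, and inserting \<open>0\<close> changes no other supremum.
\<close>

definition mv_join :: "'a set \<Rightarrow> ('a \<Rightarrow> real) set \<Rightarrow> 'a \<Rightarrow> real" where
  "mv_join X \<Gamma> = (\<lambda>x\<in>X. Sup (insert 0 ((\<lambda>f. f x) ` \<Gamma>)))"

definition mv_topology :: "'a set \<Rightarrow> ('a \<Rightarrow> real) set \<Rightarrow> bool" where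
  "mv_topology X T \<longleftrightarrow>
     T \<subseteq> fuzzy_sets X \<and> mv_zero X \<in> T \<and> mv_one X \<in> T \<and>
     (\<forall>\<Gamma>. \<Gamma> \<subseteq> T \<longrightarrow> mv_join X \<Gamma> \<in> T) \<and>
     (\<forall>f\<in>T. \<forall>g\<in>T. mv_odot X f g \<in> T \<and> mv_oplus X f g \<in> T \<and> mv_meet X f g \<in> T)"

definition mv_closed :: "'a set \<Rightarrow> ('a \<Rightarrow> real) set \<Rightarrow> ('a \<Rightarrow> real) \<Rightarrow> bool" where
  "mv_closed X T f \<longleftrightarrow> (\<exists>g\<in>T. f = mv_neg X g)"

definition mv_clopen :: "'a set \<Rightarrow> ('a \<Rightarrow> real) set \<Rightarrow> ('a \<Rightarrow> real) \<Rightarrow> bool" where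
  "mv_clopen X T f \<longleftrightarrow> f \<in> T \<and> mv_closed X T f"

definition mv_base :: "'a set \<Rightarrow> ('a \<Rightarrow> real) set \<Rightarrow> ('a \<Rightarrow> real) set \<Rightarrow> bool" where
  "mv_base X T B \<longleftrightarrow> B \<subseteq> T \<and> (\<forall>f\<in>T. \<exists>\<Gamma>. \<Gamma> \<subseteq> B \<and> f = mv_join X \<Gamma>)"

definition mv_zero_dimensional :: "'a set \<Rightarrow> ('a \<Rightarrow> real) set \<Rightarrow> bool" where
  "mv_zero_dimensional X T \<longleftrightarrow> (\<exists>B. mv_base X T B \<and> (\<forall>f\<in>B. mv_clopen X T f))"

definition mv_Hausdorff :: "'a set \<Rightarrow> ('a \<Rightarrow> real) set \<Rightarrow> bool" where
  "mv_Hausdorff X T \<longleftrightarrow>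
     (\<forall>x\<in>X. \<forall>y\<in>X. x \<noteq> y \<longrightarrow>
        (\<exists>f\<in>T. \<exists>g\<in>T. f x = 1 \<and> g y = 1 \<and> mv_meet X f g = mv_zero X))"

text \<open>
  A finite family with repetitions is a list. The empty list is allowed (its sum is the constant
  \<open>0\<close>); this matters only for the empty carrier, where the constants \<open>0\<close> and \<open>1\<close> coincide.
\<close>

definition mv_compact :: "'a set \<Rightarrow> ('a \<Rightarrow> real) set \<Rightarrow> bool" where
  "mv_compact X T \<longleftrightarrow>
     (\<forall>\<Gamma>. \<Gamma> \<subseteq> T \<and> mv_join X \<Gamma> = mv_one X \<longrightarrow>
        (\<exists>as. set as \<subseteq> \<Gamma> \<and> foldr (mv_oplus X) as (mv_zero X) = mv_one X))"

definition stone_mv_space :: "'a set \<Rightarrow> ('a \<Rightarrow> real) set \<Rightarrow> bool" where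
  "stone_mv_space X T \<longleftrightarrow>
     mv_topology X T \<and> mv_compact X T \<and> mv_Hausdorff X T \<and> mv_zero_dimensional X T"

definition mv_topology_generated_by ::
    "'a set \<Rightarrow> ('a \<Rightarrow> real) set \<Rightarrow> ('a \<Rightarrow> real) set" where
  "mv_topology_generated_by X S = \<Inter> {T. mv_topology X T \<and> S \<subseteq> T}"

definition product_mv_subbase ::
    "'i set \<Rightarrow> ('i \<Rightarrow> 'a set) \<Rightarrow> ('i \<Rightarrow> ('a \<Rightarrow> real) set) \<Rightarrow> (('i \<Rightarrow> 'a) \<Rightarrow> real) set" where
  "product_mv_subbase I X T = {(\<lambda>x\<in>Pi\<^sub>E I X. \<alpha> (x i)) | i \<alpha>. i \<in> I \<and> \<alpha> \<in> T i}"

definition product_mv_topology ::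
    "'i set \<Rightarrow> ('i \<Rightarrow> 'a set) \<Rightarrow> ('i \<Rightarrow> ('a \<Rightarrow> real) set) \<Rightarrow> (('i \<Rightarrow> 'a) \<Rightarrow> real) set" where
  "product_mv_topology I X T = mv_topology_generated_by (Pi\<^sub>E I X) (product_mv_subbase I X T)"

end

theory Submission
  imports Defs "HOL-Analysis.Function_Topology"
begin

text \<open>
  The crisp open sets of an MV-topology form a classical topology, and every open fuzzy set is lower
  semicontinuous for it. If the MV-space is compact, so is this topology. By the classical Tychonoff
  theorem the product of these topologies is compact; the functions lower semicontinuous for it form
  an MV-topology containing the subbase, hence the product MV-topology. Conversely, any family of
  lower semicontinuous functions on a compact space is MV-compact: where members of the cover exceed
  \<open>1/2\<close> one has a classical open cover. Separation is inherited from a coordinate where two points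
  differ, and zero-dimensionality holds because joins of clopens form an MV-topology.
\<close>

section \<open>Pointwise operations and joins of fuzzy sets\<close>

lemma mv_topologyD:
  assumes "mv_topology X T"
  shows "T \<subseteq> fuzzy_sets X" "mv_zero X \<in> T" "mv_one X \<in> T"
    and "\<Gamma> \<subseteq> T \<Longrightarrow> mv_join X \<Gamma> \<in> T"
    and "f \<in> T \<Longrightarrow> g \<in> T \<Longrightarrow> mv_odot X f g \<in> T"
    and "f \<in> T \<Longrightarrow> g \<in> T \<Longrightarrow> mv_oplus X f g \<in> T"
    and "f \<in> T \<Longrightarrow> g \<in> T \<Longrightarrow> mv_meet X f g \<in> T"
  using assms unfolding mv_topology_def by blast+

lemma fuzzy_sets_bounds:
  assumes "f \<in> fuzzy_sets X" "x \<in> X"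
  shows "0 \<le> f x" "f x \<le> 1"
  using assms unfolding fuzzy_sets_def by (auto simp: PiE_iff)

lemma fuzzy_sets_eqI:
  assumes "f \<in> fuzzy_sets X" "g \<in> fuzzy_sets X" "\<And>x. x \<in> X \<Longrightarrow> f x = g x"
  shows "f = g"
  using assms unfolding fuzzy_sets_def by (auto intro: PiE_ext)

text \<open>Strict lower bounds turn a supremum into an existential, so later equalities and
  inequalities with joins are checked level by level. The disjunct \<open>r < 0\<close> accounts for
  the inserted 0; the bound 1 on the members makes the supremum well behaved.\<close>

lemma less_mv_join_iff:
  assumes "\<Gamma> \<subseteq> fuzzy_sets X" "x \<in> X"
  shows "r < mv_join X \<Gamma> x \<longleftrightarrow> r < 0 \<or> (\<exists>f\<in>\<Gamma>. r < f x)"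
proof -
  have "bdd_above (insert 0 ((\<lambda>f. f x) ` \<Gamma>))"
    using assms fuzzy_sets_bounds(2) by (intro bdd_aboveI[where M = 1]) fastforce
  then show ?thesis
    using assms(2) unfolding mv_join_def by (simp add: less_cSup_iff)
qed

text \<open>Take the join's own value as the level: nothing is strictly below itself, so no member
  can exceed that value.\<close>

lemma mv_join_upper:
  assumes "\<Gamma> \<subseteq> fuzzy_sets X" "x \<in> X" "f \<in> \<Gamma>"
  shows "f x \<le> mv_join X \<Gamma> x"
  using less_mv_join_iff[OF assms(1,2), of "mv_join X \<Gamma> x"] assms(3) by (meson less_irrefl not_le)

lemma mv_join_fuzzy:
  assumes "\<Gamma> \<subseteq> fuzzy_sets X"
  shows "mv_join X \<Gamma> \<in> fuzzy_sets X"
proof -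
  have "0 \<le> mv_join X \<Gamma> x" "mv_join X \<Gamma> x \<le> 1" if "x \<in> X" for x
  proof -
    show "0 \<le> mv_join X \<Gamma> x"
      using less_mv_join_iff[OF assms that, of "mv_join X \<Gamma> x"] by auto
    show "mv_join X \<Gamma> x \<le> 1"
      using less_mv_join_iff[OF assms that, of 1] fuzzy_sets_bounds(2)[OF _ that] assms
      by (smt (verit) subsetD)
  qed
  moreover have "mv_join X \<Gamma> x = undefined" if "x \<notin> X" for x
    using that by (simp add: mv_join_def)
  ultimately show ?thesis
    unfolding fuzzy_sets_def by (auto simp: PiE_iff extensional_def)
qed

lemma fuzzy_sets_ops:
  assumes "f \<in> fuzzy_sets X" "g \<in> fuzzy_sets X"
  shows "mv_odot X f g \<in> fuzzy_sets X" "mv_oplus X f g \<in> fuzzy_sets X"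
    "mv_meet X f g \<in> fuzzy_sets X" "mv_neg X f \<in> fuzzy_sets X"
  using fuzzy_sets_bounds[OF assms(1)] fuzzy_sets_bounds[OF assms(2)]
  unfolding fuzzy_sets_def mv_odot_def mv_oplus_def mv_meet_def mv_neg_def
  by (auto simp: PiE_iff min_def max_def) (smt (verit))+

lemma fuzzy_sets_consts: "mv_zero X \<in> fuzzy_sets X" "mv_one X \<in> fuzzy_sets X"
  by (auto simp: fuzzy_sets_def mv_zero_def mv_one_def)

text \<open>This largest MV-topology is one of the sets intersected in a generated MV-topology,
  which therefore consists of fuzzy sets.\<close>

lemma mv_topology_fuzzy_sets: "mv_topology X (fuzzy_sets X)"
  unfolding mv_topology_def by (simp add: fuzzy_sets_ops fuzzy_sets_consts mv_join_fuzzy)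

section \<open>Generated MV-topologies\<close>

lemma mv_topology_generated_by_least:
  assumes "mv_topology X T" "S \<subseteq> T"
  shows "mv_topology_generated_by X S \<subseteq> T"
  using assms unfolding mv_topology_generated_by_def by blast

lemma subset_mv_topology_generated_by: "S \<subseteq> mv_topology_generated_by X S"
  unfolding mv_topology_generated_by_def by blast

lemma mv_topology_generated_by:
  assumes "S \<subseteq> fuzzy_sets X"
  shows "mv_topology X (mv_topology_generated_by X S)"
proof -
  have "mv_topology_generated_by X S \<subseteq> fuzzy_sets X"
    using mv_topology_generated_by_least[OF mv_topology_fuzzy_sets assms] .
  moreover have "mv_zero X \<in> mv_topology_generated_by X S" "mv_one X \<in> mv_topology_generated_by X S"
    unfolding mv_topology_generated_by_def using mv_topologyD(2,3) by blast+
  moreover have "mv_join X \<Gamma> \<in> mv_topology_generated_by X S"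
    if "\<Gamma> \<subseteq> mv_topology_generated_by X S" for \<Gamma>
    using that unfolding mv_topology_generated_by_def by (auto intro!: mv_topologyD(4))
  moreover have "mv_odot X f g \<in> mv_topology_generated_by X S \<and>
      mv_oplus X f g \<in> mv_topology_generated_by X S \<and> mv_meet X f g \<in> mv_topology_generated_by X S"
    if "f \<in> mv_topology_generated_by X S" "g \<in> mv_topology_generated_by X S" for f g
    using that unfolding mv_topology_generated_by_def by (simp add: mv_topologyD(5-7))
  ultimately show ?thesis
    unfolding mv_topology_def[of X "mv_topology_generated_by X S"] by blast
qed

lemma mv_ops_mono:
  assumes "x \<in> X" "b x \<le> f x" "c x \<le> g x"
  shows "mv_odot X b c x \<le> mv_odot X f g x" "mv_oplus X b c x \<le> mv_oplus X f g x"
    "mv_meet X b c x \<le> mv_meet X f g x"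
  using assms by (auto simp: mv_odot_def mv_oplus_def mv_meet_def)

text \<open>Splits a level of a sum into levels of the summands; this handles both truncated sums,
  for approximation from below and for lower semicontinuity.\<close>

lemma real_sum_less_split:
  fixes a b r :: real
  assumes "r < a + b"
  obtains q where "q < a" "r - q < b"
proof -
  have "r - b < a" using assms by simp
  then obtain q where "r - b < q" "q < a" using dense by blast
  then show ?thesis by (intro that[of q]) auto
qed


subsection \<open>Joins of a family closed under the operations\<close>

text \<open>
  The joins of members of \<open>B\<close> are described by approximation from below, which suits all operations.
\<close>

lemma mv_topology_joins:
  assumes B: "B \<subseteq> fuzzy_sets X" "mv_zero X \<in> B" "mv_one X \<in> B"
    and ops: "\<And>f g. f \<in> B \<Longrightarrow> g \<in> B \<Longrightarrow>
      mv_odot X f g \<in> B \<and> mv_oplus X f g \<in> B \<and> mv_meet X f g \<in> B"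
  shows "mv_topology X {f \<in> fuzzy_sets X. \<forall>x\<in>X. \<forall>r<f x. \<exists>b\<in>B. r < b x \<and> (\<forall>y\<in>X. b y \<le> f y)}"
    (is "mv_topology X ?D")
proof -
  have BD: "b \<in> ?D" if "b \<in> B" for b
    using that B(1) by auto
  \<comment> \<open>Negative levels are approximated by the constant 0. They need separate treatment
    because a negative level below a join need not be exceeded by any member, for instance when the
    family is empty.\<close>
  have neg: "\<exists>b\<in>B. r < b x \<and> (\<forall>y\<in>X. b y \<le> f y)" if "f \<in> fuzzy_sets X" "x \<in> X" "r < 0" for f x r
    using that B(2) fuzzy_sets_bounds(1)[OF that(1)]
    by (intro bexI[of _ "mv_zero X"]) (auto simp: mv_zero_def)
  have "mv_join X \<Gamma> \<in> ?D" if "\<Gamma> \<subseteq> ?D" for \<Gamma>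
  proof -
    have \<Gamma>: "\<Gamma> \<subseteq> fuzzy_sets X" using that by blast
    have "\<exists>b\<in>B. r < b x \<and> (\<forall>y\<in>X. b y \<le> mv_join X \<Gamma> y)" if x: "x \<in> X" and r: "r < mv_join X \<Gamma> x" for x r
    proof (cases "r < 0")
      case True
      then show ?thesis using neg mv_join_fuzzy[OF \<Gamma>] x by blast
    next
      case False
      then obtain f where "f \<in> \<Gamma>" "r < f x"
        using r less_mv_join_iff[OF \<Gamma> x] by blast
      moreover then obtain b where "b \<in> B" "r < b x" "\<forall>y\<in>X. b y \<le> f y"
        using \<open>\<Gamma> \<subseteq> ?D\<close> x by blast
      ultimately show ?thesis
        using mv_join_upper[OF \<Gamma>] by (meson order_trans)
    qed
    then show ?thesis using mv_join_fuzzy[OF \<Gamma>] by blast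
  qed
  moreover have "mv_odot X f g \<in> ?D \<and> mv_oplus X f g \<in> ?D \<and> mv_meet X f g \<in> ?D"
    if f: "f \<in> ?D" and g: "g \<in> ?D" for f g
  proof -
    have fg: "f \<in> fuzzy_sets X" "g \<in> fuzzy_sets X" using f g by auto
    have fD: "\<exists>b\<in>B. r < b x \<and> (\<forall>y\<in>X. b y \<le> f y)" if "x \<in> X" "r < f x" for x r
      using f that by blast
    have gD: "\<exists>b\<in>B. r < b x \<and> (\<forall>y\<in>X. b y \<le> g y)" if "x \<in> X" "r < g x" for x r
      using g that by blast
    have "\<exists>b\<in>B. r < b x \<and> (\<forall>y\<in>X. b y \<le> mv_odot X f g y)"
      if x: "x \<in> X" and r: "r < mv_odot X f g x" for x r
    proof (cases "r < 0")
      case True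
      then show ?thesis using neg fuzzy_sets_ops(1)[OF fg] x by blast
    next
      case False
      \<comment> \<open>For r \<ge> 0 the truncation at 0 cannot be what exceeds r, so the
        untruncated sum does.\<close>
      then have "r + 1 < f x + g x" using r x by (auto simp: mv_odot_def)
      then obtain q where "q < f x" "r + 1 - q < g x" by (rule real_sum_less_split)
      then obtain b c where "b \<in> B" "q < b x" "\<forall>y\<in>X. b y \<le> f y"
        "c \<in> B" "r + 1 - q < c x" "\<forall>y\<in>X. c y \<le> g y"
        using fD[OF x] gD[OF x] by metis
      then show ?thesis
        using x ops[of b c] mv_ops_mono(1)[of _ X b f c g]
        by (intro bexI[of _ "mv_odot X b c"]) (auto simp: mv_odot_def[of X b c])
    qed
    moreover have "\<exists>b\<in>B. r < b x \<and> (\<forall>y\<in>X. b y \<le> mv_oplus X f g y)"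
      if x: "x \<in> X" and r: "r < mv_oplus X f g x" for x r
    proof -
      \<comment> \<open>The bound \<open>r < 1\<close> is kept because the approximant
        \<open>mv_oplus X b c\<close> is itself capped at 1.\<close>
      have "r < f x + g x" "r < 1" using r x by (auto simp: mv_oplus_def)
      moreover then obtain q where "q < f x" "r - q < g x" using real_sum_less_split by blast
      ultimately obtain b c where "b \<in> B" "q < b x" "\<forall>y\<in>X. b y \<le> f y"
        "c \<in> B" "r - q < c x" "\<forall>y\<in>X. c y \<le> g y"
        using fD[OF x] gD[OF x] by metis
      then show ?thesis
        using x \<open>r < 1\<close> ops[of b c] mv_ops_mono(2)[of _ X b f c g]
        by (intro bexI[of _ "mv_oplus X b c"]) (auto simp: mv_oplus_def[of X b c])
    qed
    moreover have "\<exists>b\<in>B. r < b x \<and> (\<forall>y\<in>X. b y \<le> mv_meet X f g y)"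
      if x: "x \<in> X" and r: "r < mv_meet X f g x" for x r
    proof -
      have "r < f x" "r < g x" using r x by (auto simp: mv_meet_def)
      then obtain b c where "b \<in> B" "r < b x" "\<forall>y\<in>X. b y \<le> f y"
        "c \<in> B" "r < c x" "\<forall>y\<in>X. c y \<le> g y"
        using fD[OF x] gD[OF x] by metis
      then show ?thesis
        using x ops[of b c] mv_ops_mono(3)[of _ X b f c g]
        by (intro bexI[of _ "mv_meet X b c"]) (auto simp: mv_meet_def[of X b c])
    qed
    ultimately show ?thesis using fuzzy_sets_ops[OF fg] by blast
  qed
  ultimately show ?thesis
    using BD[OF B(2)] BD[OF B(3)] by (auto simp: mv_topology_def[of X ?D])
qed


subsection \<open>Clopen fuzzy sets\<close>

lemma mv_clopen_iff:
  assumes "T \<subseteq> fuzzy_sets X"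
  shows "mv_clopen X T f \<longleftrightarrow> f \<in> T \<and> mv_neg X f \<in> T"
proof -
  have "mv_neg X (mv_neg X f) = f" if "f \<in> T" for f
    using that assms by (intro fuzzy_sets_eqI[of _ X] fuzzy_sets_ops(4)) (auto simp: mv_neg_def)
  then show ?thesis
    unfolding mv_clopen_def mv_closed_def by metis
qed

text \<open>De Morgan: complement exchanges \<open>mv_odot\<close> and \<open>mv_oplus\<close>, and
  turns a meet into a join of two open sets.\<close>

lemma mv_clopen_ops:
  assumes T: "mv_topology X T" and f: "mv_clopen X T f" and g: "mv_clopen X T g"
  shows "mv_clopen X T (mv_odot X f g)" "mv_clopen X T (mv_oplus X f g)" "mv_clopen X T (mv_meet X f g)"
proof -
  note clopen = mv_clopen_iff[OF mv_topologyD(1)[OF T]]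
  have fg: "f \<in> T" "g \<in> T" "mv_neg X f \<in> T" "mv_neg X g \<in> T"
    using f g clopen by auto
  have "mv_neg X (mv_odot X f g) = mv_oplus X (mv_neg X f) (mv_neg X g)"
    by (intro ext) (simp add: mv_odot_def mv_oplus_def mv_neg_def min_def max_def)
  then show "mv_clopen X T (mv_odot X f g)"
    using fg mv_topologyD[OF T] by (simp add: clopen)
  have "mv_neg X (mv_oplus X f g) = mv_odot X (mv_neg X f) (mv_neg X g)"
    by (intro ext) (simp add: mv_odot_def mv_oplus_def mv_neg_def min_def max_def)
  then show "mv_clopen X T (mv_oplus X f g)"
    using fg mv_topologyD[OF T] by (simp add: clopen)
  have "mv_neg X (mv_meet X f g) = mv_join X {mv_neg X f, mv_neg X g}"
  proof (rule fuzzy_sets_eqI)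
    have sub: "{mv_neg X f, mv_neg X g} \<subseteq> fuzzy_sets X"
      using fg mv_topologyD(1)[OF T] by auto
    show "mv_join X {mv_neg X f, mv_neg X g} \<in> fuzzy_sets X"
      by (rule mv_join_fuzzy[OF sub])
    show "mv_neg X (mv_meet X f g) \<in> fuzzy_sets X"
      using fg mv_topologyD(1)[OF T] by (intro fuzzy_sets_ops) auto
    show "mv_neg X (mv_meet X f g) x = mv_join X {mv_neg X f, mv_neg X g} x" if x: "x \<in> X" for x
    proof -
      have "r < mv_neg X (mv_meet X f g) x \<longleftrightarrow> r < mv_join X {mv_neg X f, mv_neg X g} x" for r
        using x fuzzy_sets_bounds(2)[OF _ x, of f] fg mv_topologyD(1)[OF T]
        unfolding less_mv_join_iff[OF sub x] by (force simp: mv_meet_def mv_neg_def)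
      then show ?thesis by (meson less_irrefl linorder_neqE)
    qed
  qed
  then show "mv_clopen X T (mv_meet X f g)"
    using fg mv_topologyD[OF T] by (simp add: clopen)
qed

lemma mv_clopen_consts:
  assumes T: "mv_topology X T"
  shows "mv_clopen X T (mv_zero X)" "mv_clopen X T (mv_one X)"
proof -
  have "mv_neg X (mv_zero X) = mv_one X" "mv_neg X (mv_one X) = mv_zero X"
    by (auto simp: mv_zero_def mv_one_def mv_neg_def)
  then show "mv_clopen X T (mv_zero X)" "mv_clopen X T (mv_one X)"
    using mv_topologyD[OF T] by (simp_all add: mv_clopen_iff)
qed

text \<open>The clopens are closed under the operations, so the functions they approximate from
  below form an MV-topology. It contains \<open>S\<close>, hence everything that \<open>S\<close>
  generates. Only the levels r \<ge> 0 are left to the caller, since the constant 0 serves the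
  others.\<close>

lemma mv_zero_dimensional_generated_by:
  assumes S: "S \<subseteq> fuzzy_sets X"
    and clopen: "\<And>f x r. f \<in> S \<Longrightarrow> x \<in> X \<Longrightarrow> 0 \<le> r \<Longrightarrow> r < f x \<Longrightarrow>
      \<exists>b. mv_clopen X (mv_topology_generated_by X S) b \<and> r < b x \<and> (\<forall>y\<in>X. b y \<le> f y)"
  shows "mv_zero_dimensional X (mv_topology_generated_by X S)"
proof -
  define T where "T = mv_topology_generated_by X S"
  have T: "mv_topology X T"
    unfolding T_def by (rule mv_topology_generated_by[OF S])
  define B where "B = {b. mv_clopen X T b}"
  have BT: "B \<subseteq> T" by (auto simp: B_def mv_clopen_def)
  have B: "B \<subseteq> fuzzy_sets X" using BT mv_topologyD(1)[OF T] by blast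
  have zB: "mv_zero X \<in> B" using mv_clopen_consts[OF T] by (simp add: B_def)
  define D where "D = {f \<in> fuzzy_sets X. \<forall>x\<in>X. \<forall>r<f x. \<exists>b\<in>B. r < b x \<and> (\<forall>y\<in>X. b y \<le> f y)}"
  have "mv_topology X D"
    unfolding D_def using B zB mv_clopen_consts(2)[OF T] mv_clopen_ops[OF T]
    by (intro mv_topology_joins) (auto simp: B_def)
  moreover have "S \<subseteq> D"
  proof
    fix f assume f: "f \<in> S"
    have "\<exists>b\<in>B. r < b x \<and> (\<forall>y\<in>X. b y \<le> f y)" if "x \<in> X" "r < f x" for x r
    proof (cases "0 \<le> r")
      case True
      then show ?thesis using clopen[OF f] that by (auto simp: B_def T_def)
    next
      case False
      then show ?thesis
        using zB that fuzzy_sets_bounds(1)[of f X] S f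
        by (intro bexI[of _ "mv_zero X"]) (auto simp: mv_zero_def)
    qed
    then show "f \<in> D" using S f by (auto simp: D_def)
  qed
  ultimately have TD: "T \<subseteq> D"
    unfolding T_def by (rule mv_topology_generated_by_least)
  have "\<exists>\<Gamma>\<subseteq>B. f = mv_join X \<Gamma>" if "f \<in> T" for f
  proof -
    \<comment> \<open>All clopens below f: the largest family whose join can be f.\<close>
    define \<Gamma> where "\<Gamma> = {b \<in> B. \<forall>y\<in>X. b y \<le> f y}"
    have \<Gamma>: "\<Gamma> \<subseteq> fuzzy_sets X" using B by (auto simp: \<Gamma>_def)
    have f: "f \<in> D" using TD that by blast
    have "f = mv_join X \<Gamma>"
    proof (rule fuzzy_sets_eqI)
      show "f \<in> fuzzy_sets X" using f by (simp add: D_def)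
      show "mv_join X \<Gamma> \<in> fuzzy_sets X" by (rule mv_join_fuzzy[OF \<Gamma>])
      show "f x = mv_join X \<Gamma> x" if x: "x \<in> X" for x
      proof -
        have "r < f x \<longleftrightarrow> r < mv_join X \<Gamma> x" for r
          using f x fuzzy_sets_bounds(1)[OF _ x, of f]
          unfolding less_mv_join_iff[OF \<Gamma> x] by (fastforce simp: D_def \<Gamma>_def)
        then show ?thesis by (meson less_irrefl linorder_neqE)
      qed
    qed
    then show ?thesis by (intro exI[of _ \<Gamma>]) (auto simp: \<Gamma>_def)
  qed
  then show ?thesis
    using BT unfolding mv_zero_dimensional_def mv_base_def T_def[symmetric]
    by (intro exI[of _ B]) (auto simp: B_def)
qed


subsection \<open>Lower semicontinuous fuzzy sets\<close>

definition lsc_fuzzy_sets :: "'a topology \<Rightarrow> ('a \<Rightarrow> real) set" where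
  "lsc_fuzzy_sets P = {f \<in> fuzzy_sets (topspace P). \<forall>r. openin P {x \<in> topspace P. r < f x}}"

text \<open>Level sets of a join are unions, those of a meet intersections, and those of a sum
  unions of intersections over all splittings of the level. Truncation only adds or intersects a set
  that is empty or the whole space.\<close>

lemma mv_topology_lsc_fuzzy_sets: "mv_topology (topspace P) (lsc_fuzzy_sets P)"
proof -
  define X where "X = topspace P"
  define L where "L = lsc_fuzzy_sets P"
  have L: "f \<in> L \<longleftrightarrow> f \<in> fuzzy_sets X \<and> (\<forall>r. openin P {x \<in> X. r < f x})" for f
    by (simp add: L_def X_def lsc_fuzzy_sets_def)
  have const: "openin P {x \<in> X. Q}" for Q
    by (cases Q) (auto simp: X_def)
  have "mv_zero X \<in> L" "mv_one X \<in> L"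
    using const fuzzy_sets_consts[of X] by (auto simp: L mv_zero_def mv_one_def cong: conj_cong)
  moreover have "mv_join X \<Gamma> \<in> L" if "\<Gamma> \<subseteq> L" for \<Gamma>
  proof -
    have \<Gamma>: "\<Gamma> \<subseteq> fuzzy_sets X" using that L by auto
    have "openin P {x \<in> X. r < mv_join X \<Gamma> x}" for r
    proof -
      have "{x \<in> X. r < mv_join X \<Gamma> x} = {x \<in> X. r < 0} \<union> (\<Union>f\<in>\<Gamma>. {x \<in> X. r < f x})"
        using less_mv_join_iff[OF \<Gamma>] by blast
      then show ?thesis using const that L by (auto intro!: openin_Un openin_Union)
    qed
    then show ?thesis using L mv_join_fuzzy[OF \<Gamma>] by simp
  qed
  moreover have "mv_odot X f g \<in> L \<and> mv_oplus X f g \<in> L \<and> mv_meet X f g \<in> L"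
    if f: "f \<in> L" and g: "g \<in> L" for f g
  proof -
    have add: "openin P {x \<in> X. r < f x + g x}" for r
    proof -
      have "{x \<in> X. r < f x + g x} = (\<Union>q. {x \<in> X. q < f x} \<inter> {x \<in> X. r - q < g x})"
        by (auto elim: real_sum_less_split)
      then show ?thesis using f g L by (auto intro!: openin_Union openin_Int)
    qed
    have "{x \<in> X. r < mv_odot X f g x} = {x \<in> X. r < 0} \<union> {x \<in> X. r + 1 < f x + g x}"
      "{x \<in> X. r < mv_oplus X f g x} = {x \<in> X. r < 1} \<inter> {x \<in> X. r < f x + g x}"
      "{x \<in> X. r < mv_meet X f g x} = {x \<in> X. r < f x} \<inter> {x \<in> X. r < g x}" for r
      by (auto simp: mv_odot_def mv_oplus_def mv_meet_def)
    then show ?thesis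
      using add const f g fuzzy_sets_ops[of f X g] by (auto simp: L)
  qed
  ultimately show ?thesis
    unfolding mv_topology_def X_def[symmetric] L_def[symmetric] using L by blast
qed

text \<open>Since all values are nonnegative, a partial sum once capped at 1 stays at 1, so
  truncating once at the end gives the same result.\<close>

lemma foldr_mv_oplus:
  assumes "set as \<subseteq> fuzzy_sets X" "x \<in> X"
  shows "foldr (mv_oplus X) as (mv_zero X) x = min (\<Sum>a\<leftarrow>as. a x) 1"
  using assms
proof (induction as)
  case (Cons a as)
  have "0 \<le> a x" using Cons.prems fuzzy_sets_bounds(1) by auto
  then show ?case using Cons by (auto simp: mv_oplus_def)
qed (simp add: mv_zero_def)

lemma foldr_mv_oplus_fuzzy:
  assumes "set as \<subseteq> fuzzy_sets X"
  shows "foldr (mv_oplus X) as (mv_zero X) \<in> fuzzy_sets X"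
  using assms by (induction as) (auto intro: fuzzy_sets_ops fuzzy_sets_consts)

text \<open>
  Listing every member of the finite subcover twice makes the truncated sum equal to \<open>1\<close>.
\<close>

lemma mv_compact_lsc:
  assumes P: "compact_space P" and T: "T \<subseteq> lsc_fuzzy_sets P"
  shows "mv_compact (topspace P) T"
  unfolding mv_compact_def
proof safe
  fix \<Gamma> assume "\<Gamma> \<subseteq> T" and one: "mv_join (topspace P) \<Gamma> = mv_one (topspace P)"
  define X where "X = topspace P"
  define U where "U f = {x \<in> X. 1/2 < f x}" for f :: "'a \<Rightarrow> real"
  have \<Gamma>: "\<Gamma> \<subseteq> fuzzy_sets X"
    using \<open>\<Gamma> \<subseteq> T\<close> T by (auto simp: lsc_fuzzy_sets_def X_def)
  have "\<forall>f\<in>\<Gamma>. openin P (U f)"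
    using \<open>\<Gamma> \<subseteq> T\<close> T unfolding lsc_fuzzy_sets_def X_def U_def by blast
  moreover have "X \<subseteq> \<Union> (U ` \<Gamma>)"
  proof
    fix x assume x: "x \<in> X"
    then have "1/2 < mv_join X \<Gamma> x" using one by (simp add: X_def mv_one_def)
    then show "x \<in> \<Union> (U ` \<Gamma>)"
      using less_mv_join_iff[OF \<Gamma> x, of "1/2"] x by (auto simp: U_def)
  qed
  ultimately obtain \<F> where "finite \<F>" "\<F> \<subseteq> U ` \<Gamma>" "X \<subseteq> \<Union>\<F>"
    using P unfolding compact_space_alt X_def by (metis (no_types, lifting) imageE)
  then obtain F where F: "finite F" "F \<subseteq> \<Gamma>" "X \<subseteq> \<Union> (U ` F)"
    by (metis finite_subset_image)
  obtain fs where fs: "set fs = F" using finite_list[OF F(1)] by blast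
  have sub: "set (fs @ fs) \<subseteq> fuzzy_sets X" using fs F(2) \<Gamma> by auto
  have "foldr (mv_oplus X) (fs @ fs) (mv_zero X) = mv_one X"
  proof (rule fuzzy_sets_eqI)
    show "foldr (mv_oplus X) (fs @ fs) (mv_zero X) \<in> fuzzy_sets X"
      by (rule foldr_mv_oplus_fuzzy[OF sub])
    show "mv_one X \<in> fuzzy_sets X" by (rule fuzzy_sets_consts)
    fix x assume x: "x \<in> X"
    then obtain f where f: "f \<in> set fs" "1/2 < f x" using F(3) fs by (auto simp: U_def)
    have "f x \<le> (\<Sum>a\<leftarrow>fs. a x)"
      using f(1) sub fuzzy_sets_bounds(1)[OF _ x] by (intro member_le_sum_list) auto
    then show "foldr (mv_oplus X) (fs @ fs) (mv_zero X) x = mv_one X x"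
      using f(2) x unfolding foldr_mv_oplus[OF sub x] by (simp add: mv_one_def)
  qed
  then show "\<exists>as. set as \<subseteq> \<Gamma> \<and>
      foldr (mv_oplus (topspace P)) as (mv_zero (topspace P)) = mv_one (topspace P)"
    using fs F(2) unfolding X_def by (intro exI[of _ "fs @ fs"]) auto
qed


subsection \<open>The topology of crisp open sets\<close>

definition crisp :: "'a set \<Rightarrow> 'a set \<Rightarrow> 'a \<Rightarrow> real" where
  "crisp X U = (\<lambda>x\<in>X. if x \<in> U then 1 else 0)"

text \<open>As \<open>crisp X U\<close> depends only on U \<inter> X, the clause U \<subseteq> X is
  what confines the open sets to the carrier.\<close>

definition crisp_topology :: "'a set \<Rightarrow> ('a \<Rightarrow> real) set \<Rightarrow> 'a topology" where
  "crisp_topology X T = topology (\<lambda>U. U \<subseteq> X \<and> crisp X U \<in> T)"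

lemma crisp_fuzzy: "crisp X U \<in> fuzzy_sets X"
  by (auto simp: crisp_def fuzzy_sets_def)

text \<open>Indicators turn intersections into meets and unions into joins, so the axioms of a
  topology come from those of an MV-topology.\<close>

lemma openin_crisp_topology:
  assumes T: "mv_topology X T"
  shows "openin (crisp_topology X T) U \<longleftrightarrow> U \<subseteq> X \<and> crisp X U \<in> T"
proof -
  have "crisp X (U \<inter> V) = mv_meet X (crisp X U) (crisp X V)" for U V
    by (auto simp: crisp_def mv_meet_def)
  moreover have "crisp X (\<Union>\<K>) = mv_join X (crisp X ` \<K>)" for \<K>
  proof (rule fuzzy_sets_eqI)
    have sub: "crisp X ` \<K> \<subseteq> fuzzy_sets X" using crisp_fuzzy by blast
    show "crisp X (\<Union>\<K>) \<in> fuzzy_sets X" by (rule crisp_fuzzy)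
    show "mv_join X (crisp X ` \<K>) \<in> fuzzy_sets X" by (rule mv_join_fuzzy[OF sub])
    show "crisp X (\<Union>\<K>) x = mv_join X (crisp X ` \<K>) x" if x: "x \<in> X" for x
    proof -
      have "r < crisp X (\<Union>\<K>) x \<longleftrightarrow> r < mv_join X (crisp X ` \<K>) x" for r
        using x unfolding less_mv_join_iff[OF sub x] by (auto simp: crisp_def)
      then show ?thesis by (meson less_irrefl linorder_neqE)
    qed
  qed
  ultimately have "istopology (\<lambda>U. U \<subseteq> X \<and> crisp X U \<in> T)"
    unfolding istopology_def using mv_topologyD(4,7)[OF T]
    by (simp add: Sup_le_iff image_subset_iff le_infI1)
  then show ?thesis
    by (simp add: crisp_topology_def)
qed

lemma topspace_crisp_topology:
  assumes T: "mv_topology X T"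
  shows "topspace (crisp_topology X T) = X"
proof -
  have "crisp X X = mv_one X" by (auto simp: crisp_def mv_one_def)
  then have "openin (crisp_topology X T) X"
    using mv_topologyD(3)[OF T] by (simp add: openin_crisp_topology[OF T])
  then show ?thesis
    unfolding topspace_def openin_crisp_topology[OF T] by blast
qed

text \<open>A classical open cover becomes a cover by indicators. At a point missed by the finitely
  many chosen sets, all chosen indicators vanish, so their truncated sum could not be 1
  there.\<close>

lemma compact_space_crisp_topology:
  assumes T: "mv_topology X T" and "mv_compact X T"
  shows "compact_space (crisp_topology X T)"
  unfolding compact_space_alt topspace_crisp_topology[OF T]
proof (intro allI impI, elim conjE)
  fix \<U> assume \<U>: "\<forall>U\<in>\<U>. openin (crisp_topology X T) U" "X \<subseteq> \<Union>\<U>"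
  have sub: "crisp X ` \<U> \<subseteq> fuzzy_sets X" using crisp_fuzzy by blast
  have "mv_join X (crisp X ` \<U>) = mv_one X"
  proof (rule fuzzy_sets_eqI)
    show "mv_join X (crisp X ` \<U>) \<in> fuzzy_sets X" by (rule mv_join_fuzzy[OF sub])
    show "mv_one X \<in> fuzzy_sets X" by (rule fuzzy_sets_consts)
    show "mv_join X (crisp X ` \<U>) x = mv_one X x" if x: "x \<in> X" for x
    proof -
      obtain U where "U \<in> \<U>" "x \<in> U" using \<U>(2) x by blast
      then have "1 \<le> mv_join X (crisp X ` \<U>) x"
        using mv_join_upper[OF sub x, of "crisp X U"] x by (simp add: crisp_def)
      then show ?thesis
        using fuzzy_sets_bounds(2)[OF mv_join_fuzzy[OF sub] x] x by (simp add: mv_one_def)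
    qed
  qed
  moreover have "crisp X ` \<U> \<subseteq> T" using \<U>(1) by (auto simp: openin_crisp_topology[OF T])
  ultimately obtain as where as: "set as \<subseteq> crisp X ` \<U>"
    "foldr (mv_oplus X) as (mv_zero X) = mv_one X"
    using assms(2) unfolding mv_compact_def by metis
  then obtain \<F> where \<F>: "finite \<F>" "\<F> \<subseteq> \<U>" "set as = crisp X ` \<F>"
    by (metis finite_set finite_subset_image)
  have "X \<subseteq> \<Union>\<F>"
  proof (rule ccontr)
    assume "\<not> X \<subseteq> \<Union>\<F>"
    then obtain x where x: "x \<in> X" "x \<notin> \<Union>\<F>" by blast
    then have "\<forall>a\<in>set as. a x = 0"
      using \<F>(3) by (auto simp: crisp_def)
    then have "(\<Sum>a\<leftarrow>as. a x) = 0"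
      by (induction as) auto
    moreover have "set as \<subseteq> fuzzy_sets X" using as(1) sub by blast
    ultimately have "foldr (mv_oplus X) as (mv_zero X) x = 0"
      using foldr_mv_oplus x(1) by fastforce
    then show False using as(2) x(1) by (simp add: mv_one_def)
  qed
  then show "\<exists>\<F>. finite \<F> \<and> \<F> \<subseteq> \<U> \<and> X \<subseteq> \<Union>\<F>" using \<F> by blast
qed

section \<open>Level sets of open fuzzy sets are crisp open\<close>

text \<open>The n-fold sum of f with itself takes the value min (n * f x) 1. By the Archimedean
  property this reaches 1 wherever f is positive, and it stays 0 elsewhere, so the join over n is
  the indicator of the support.\<close>

lemma openin_crisp_topology_support:
  assumes T: "mv_topology X T" and f: "f \<in> T"
  shows "openin (crisp_topology X T) {x \<in> X. 0 < f x}"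
proof -
  define s where "s n = foldr (mv_oplus X) (replicate n f) (mv_zero X)" for n
  have fX: "f \<in> fuzzy_sets X" using f mv_topologyD(1)[OF T] by blast
  have sT: "s n \<in> T" for n
    unfolding s_def by (induction n) (use f mv_topologyD[OF T] in auto)
  have s: "s n x = min (n * f x) 1" if "x \<in> X" for n x
    unfolding s_def using fX that
    by (subst foldr_mv_oplus) (auto simp: map_replicate_const sum_list_replicate)
  have sub: "range s \<subseteq> fuzzy_sets X" using sT mv_topologyD(1)[OF T] by blast
  have "crisp X {x \<in> X. 0 < f x} = mv_join X (range s)"
  proof (rule fuzzy_sets_eqI)
    show "crisp X {x \<in> X. 0 < f x} \<in> fuzzy_sets X" by (rule crisp_fuzzy)
    show "mv_join X (range s) \<in> fuzzy_sets X" by (rule mv_join_fuzzy[OF sub])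
    show "crisp X {x \<in> X. 0 < f x} x = mv_join X (range s) x" if x: "x \<in> X" for x
    proof (cases "0 < f x")
      case True
      then obtain n :: nat where "1 < n * f x" using reals_Archimedean3 by blast
      then have "1 \<le> mv_join X (range s) x"
        using mv_join_upper[OF sub x, of "s n"] s[OF x, of n] by simp
      then show ?thesis
        using True x fuzzy_sets_bounds(2)[OF mv_join_fuzzy[OF sub] x] by (simp add: crisp_def)
    next
      case False
      then have "f x = 0" using fuzzy_sets_bounds(1)[OF fX x] by simp
      then have "\<not> 0 < mv_join X (range s) x"
        unfolding less_mv_join_iff[OF sub x] using s[OF x] by auto
      then show ?thesis
        using False x fuzzy_sets_bounds(1)[OF mv_join_fuzzy[OF sub] x] by (simp add: crisp_def)
    qed
  qed
  then show ?thesis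
    unfolding openin_crisp_topology[OF T] using mv_topologyD(4)[OF T, of "range s"] sT by auto
qed

text \<open>
  For \<open>0 \<le> r < 1\<close>, \<open>f \<oplus> f > r\<close> means \<open>f > r/2\<close> and \<open>f \<odot> f > r\<close> means \<open>f > (1 + r)/2\<close>;
  starting from \<open>r = 0\<close> this reaches every dyadic level.
\<close>

lemma openin_crisp_topology_dyadic:
  assumes T: "mv_topology X T" and "f \<in> T" "k < 2 ^ n"
  shows "openin (crisp_topology X T) {x \<in> X. real k / 2 ^ n < f x}"
  using assms(2,3)
\<comment> \<open>f varies because the induction hypothesis is applied to f \<oplus> f in the lower
  half of the levels and to f \<odot> f in the upper half. For n = 0 only the level 0, the support,
  remains.\<close>
proof (induction n arbitrary: f k)
  case 0
  then show ?case using openin_crisp_topology_support[OF T] by simp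
next
  case (Suc n)
  show ?case
  proof (cases "k < 2 ^ n")
    case True
    then have "real k / 2 ^ n < 1" by (simp add: of_nat_less_numeral_power_cancel_iff)
    moreover have "real k / 2 ^ Suc n < f x \<longleftrightarrow> real k / 2 ^ n < f x + f x" for x
      by (simp add: field_simps)
    ultimately have "{x \<in> X. real k / 2 ^ Suc n < f x} = {x \<in> X. real k / 2 ^ n < mv_oplus X f f x}"
      by (auto simp: mv_oplus_def)
    then show ?thesis using Suc.IH[OF _ True] Suc.prems(1) mv_topologyD(6)[OF T] by simp
  next
    case False
    then obtain m where k: "k = 2 ^ n + m" using le_Suc_ex not_less by blast
    define c where "c = real m / 2 ^ n"
    have "real k / 2 ^ Suc n = (1 + c) / 2" by (simp add: k c_def field_simps)
    moreover have "(1 + c) / 2 < f x \<longleftrightarrow> c < mv_odot X f f x" if "x \<in> X" for x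
    proof -
      have "0 \<le> c" by (simp add: c_def)
      then show ?thesis using that by (auto simp: mv_odot_def less_max_iff_disj)
    qed
    ultimately have "{x \<in> X. real k / 2 ^ Suc n < f x} = {x \<in> X. c < mv_odot X f f x}"
      by (metis (no_types, lifting))
    moreover have "m < 2 ^ n" using Suc.prems(2) k by simp
    ultimately show ?thesis
      using Suc.IH[of "mv_odot X f f" m] Suc.prems(1) mv_topologyD(5)[OF T] by (simp add: c_def)
  qed
qed

text \<open>Scaling by 2 ^ n stretches the interval to length greater than 1, so the first integer
  above its left end lies inside. With 0 \<le> a that integer is a natural number.\<close>

lemma dyadic_dense:
  fixes a b :: real
  assumes "0 \<le> a" "a < b"
  obtains k n :: nat where "a < k / 2 ^ n" "k / 2 ^ n < b"
proof -
  obtain n where n: "1 / (b - a) < 2 ^ n"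
    using real_arch_pow[of 2 "1 / (b - a)"] by auto
  then have n': "1 < 2 ^ n * b - 2 ^ n * a" using assms(2) by (simp add: field_simps)
  define k where "k = nat \<lfloor>2 ^ n * a\<rfloor> + 1"
  have "0 \<le> \<lfloor>2 ^ n * a\<rfloor>" using assms(1) by simp
  then have "real k = of_int \<lfloor>2 ^ n * a\<rfloor> + 1" by (simp add: k_def)
  then have "2 ^ n * a < k" "k < 2 ^ n * b"
    using n' by linarith+
  then show ?thesis by (intro that[of k n]) (simp_all add: field_simps)
qed

text \<open>For r \<ge> 0 the level set is the union of the level sets at dyadic levels between r
  and 1; for r < 0 it is the whole carrier.\<close>

lemma mv_topology_subset_lsc:
  assumes T: "mv_topology X T"
  shows "T \<subseteq> lsc_fuzzy_sets (crisp_topology X T)"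
proof
  fix f assume f: "f \<in> T"
  have fX: "f \<in> fuzzy_sets X" using f mv_topologyD(1)[OF T] by blast
  have "openin (crisp_topology X T) {x \<in> X. r < f x}" for r
  proof (cases "0 \<le> r")
    case True
    define D where "D = {(k, n). r < real k / 2 ^ n \<and> k < 2 ^ n}"
    have "{x \<in> X. r < f x} = (\<Union>(k, n)\<in>D. {x \<in> X. real k / 2 ^ n < f x})"
    proof (intro equalityI subsetI)
      fix x assume x: "x \<in> {x \<in> X. r < f x}"
      then obtain k n :: nat where kn: "r < k / 2 ^ n" "k / 2 ^ n < f x"
        using dyadic_dense[OF True] by blast
      \<comment> \<open>A dyadic level below f x is below 1, as
        \<open>openin_crisp_topology_dyadic\<close> requires.\<close>
      moreover have "f x \<le> 1" using fuzzy_sets_bounds(2)[OF fX] x by simp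
      ultimately have "real k / 2 ^ n < 1" by linarith
      then have "k < 2 ^ n" by (simp add: of_nat_less_numeral_power_cancel_iff)
      then show "x \<in> (\<Union>(k, n)\<in>D. {x \<in> X. real k / 2 ^ n < f x})"
        using kn x by (auto simp: D_def)
    qed (auto simp: D_def)
    then show ?thesis
      using openin_crisp_topology_dyadic[OF T f] by (auto simp: D_def intro!: openin_Union)
  next
    case False
    then have "{x \<in> X. r < f x} = X" using fuzzy_sets_bounds(1)[OF fX] by force
    then show ?thesis using topspace_crisp_topology[OF T] by (metis openin_topspace)
  qed
  then show "f \<in> lsc_fuzzy_sets (crisp_topology X T)"
    using fX by (simp add: lsc_fuzzy_sets_def topspace_crisp_topology[OF T])
qed


subsection \<open>Products\<close>

text \<open>Makes the pullback of a clopen along a projection clopen, since its complement is again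
  a subbasic open.\<close>

lemma mv_neg_comp_projection:
  assumes "i \<in> I"
  shows "mv_neg (Pi\<^sub>E I X) (\<lambda>x\<in>Pi\<^sub>E I X. \<alpha> (x i)) = (\<lambda>x\<in>Pi\<^sub>E I X. mv_neg (X i) \<alpha> (x i))"
  using assms by (auto simp: mv_neg_def PiE_mem)

theorem corollary6p3:
  fixes I :: "'i set"
    and X :: "'i \<Rightarrow> 'a set"
    and T :: "'i \<Rightarrow> ('a \<Rightarrow> real) set"
  assumes "\<And>i. i \<in> I \<Longrightarrow> stone_mv_space (X i) (T i)"
  shows "stone_mv_space (Pi\<^sub>E I X) (product_mv_topology I X T)"
proof -
  define Z where "Z = Pi\<^sub>E I X"
  define S where "S = product_mv_subbase I X T"
  define \<tau> where "\<tau> = product_mv_topology I X T"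
  have \<tau>: "\<tau> = mv_topology_generated_by Z S"
    by (simp add: \<tau>_def product_mv_topology_def Z_def S_def)
  have T: "mv_topology (X i) (T i)" and cpt: "mv_compact (X i) (T i)"
    and hd: "mv_Hausdorff (X i) (T i)" and zd: "mv_zero_dimensional (X i) (T i)" if "i \<in> I" for i
    using assms[OF that] by (auto simp: stone_mv_space_def)
  have Z: "x i \<in> X i" if "x \<in> Z" "i \<in> I" for x i
    using that by (auto simp: Z_def)
  have SI: "(\<lambda>x\<in>Z. \<alpha> (x i)) \<in> S" if "i \<in> I" "\<alpha> \<in> T i" for i \<alpha>
    using that by (auto simp: S_def product_mv_subbase_def Z_def)
  have SE: "\<exists>i\<in>I. \<exists>\<alpha>\<in>T i. h = (\<lambda>x\<in>Z. \<alpha> (x i))" if "h \<in> S" for h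
    using that by (auto simp: S_def product_mv_subbase_def Z_def)
  have S\<tau>: "S \<subseteq> \<tau>" unfolding \<tau> by (rule subset_mv_topology_generated_by)

  define P where "P = product_topology (\<lambda>i. crisp_topology (X i) (T i)) I"
  have tP: "topspace P = Z"
    using topspace_crisp_topology T by (auto simp: P_def Z_def intro!: PiE_cong)
  have SP: "S \<subseteq> lsc_fuzzy_sets P"
  proof
    fix h assume "h \<in> S"
    then obtain i \<alpha> where i: "i \<in> I" "\<alpha> \<in> T i" "h = (\<lambda>x\<in>Z. \<alpha> (x i))" using SE by blast
    define C where "C = crisp_topology (X i) (T i)"
    have \<alpha>: "\<alpha> \<in> lsc_fuzzy_sets C" and C: "topspace C = X i"
      using mv_topology_subset_lsc[OF T] topspace_crisp_topology[OF T] i by (auto simp: C_def)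
    have "openin P {x \<in> Z. r < h x}" for r
    proof -
      \<comment> \<open>The level sets of a subbasic function are preimages of level sets of
        \<alpha> under a continuous projection.\<close>
      have "continuous_map P C (\<lambda>x. x i)"
        unfolding P_def C_def by (rule continuous_map_product_projection[OF i(1)])
      moreover have "openin C {y \<in> X i. r < \<alpha> y}"
        using \<alpha> by (simp add: lsc_fuzzy_sets_def C)
      ultimately have "openin P {x \<in> topspace P. x i \<in> {y \<in> X i. r < \<alpha> y}}"
        by (rule openin_continuous_map_preimage)
      moreover have "{x \<in> topspace P. x i \<in> {y \<in> X i. r < \<alpha> y}} = {x \<in> Z. r < h x}"
        using Z[OF _ i(1)] by (auto simp: i(3) tP)
      ultimately show ?thesis by simp
    qed
    moreover have "h \<in> fuzzy_sets Z"
      using \<alpha> Z[OF _ i(1)] by (auto simp: i(3) lsc_fuzzy_sets_def C fuzzy_sets_def)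
    ultimately show "h \<in> lsc_fuzzy_sets P" by (simp add: lsc_fuzzy_sets_def tP)
  qed
  then have SZ: "S \<subseteq> fuzzy_sets Z" by (auto simp: lsc_fuzzy_sets_def tP)
  then have top: "mv_topology Z \<tau>" unfolding \<tau> by (rule mv_topology_generated_by)

  have "\<tau> \<subseteq> lsc_fuzzy_sets P"
    unfolding \<tau> using mv_topology_lsc_fuzzy_sets[of P] SP
    by (intro mv_topology_generated_by_least) (simp_all add: tP)
  \<comment> \<open>Tychonoff's theorem for the crisp topologies of the factors.\<close>
  moreover have "compact_space P"
    unfolding P_def using compact_space_crisp_topology[OF T cpt]
    by (simp add: compact_space_product_topology)
  ultimately have "mv_compact Z \<tau>" using mv_compact_lsc[of P \<tau>] tP by simp

  moreover have "mv_Hausdorff Z \<tau>"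
    unfolding mv_Hausdorff_def
  proof (intro ballI impI)
    fix x y assume xy: "x \<in> Z" "y \<in> Z" "x \<noteq> y"
    \<comment> \<open>Points of Z are fixed outside I, so distinct ones differ at an index in
      I.\<close>
    then obtain i where i: "i \<in> I" "x i \<noteq> y i"
      unfolding Z_def by (meson PiE_ext)
    then obtain f g where fg: "f \<in> T i" "g \<in> T i" "f (x i) = 1" "g (y i) = 1"
      "mv_meet (X i) f g = mv_zero (X i)"
      using hd[OF i(1)] Z[OF _ i(1)] xy unfolding mv_Hausdorff_def by metis
    have "min (f z) (g z) = 0" if "z \<in> X i" for z
      using fun_cong[OF fg(5), of z] that by (simp add: mv_meet_def mv_zero_def)
    then have "mv_meet Z (\<lambda>x\<in>Z. f (x i)) (\<lambda>x\<in>Z. g (x i)) = mv_zero Z"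
      using Z[OF _ i(1)] by (auto simp: mv_meet_def mv_zero_def)
    then show "\<exists>f\<in>\<tau>. \<exists>g\<in>\<tau>. f x = 1 \<and> g y = 1 \<and> mv_meet Z f g = mv_zero Z"
      using SI[OF i(1)] fg S\<tau> xy
      by (intro bexI[of _ "\<lambda>x\<in>Z. f (x i)"] bexI[of _ "\<lambda>x\<in>Z. g (x i)"]) auto
  qed

  moreover have "mv_zero_dimensional Z \<tau>"
    unfolding \<tau>
  proof (rule mv_zero_dimensional_generated_by[OF SZ])
    fix h x and r :: real assume h: "h \<in> S" and x: "x \<in> Z" and r: "0 \<le> r" "r < h x"
    then obtain i \<alpha> where i: "i \<in> I" "\<alpha> \<in> T i" "h = (\<lambda>x\<in>Z. \<alpha> (x i))" using SE by blast
    obtain B where B: "mv_base (X i) (T i) B" "\<forall>b\<in>B. mv_clopen (X i) (T i) b"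
      using zd[OF i(1)] unfolding mv_zero_dimensional_def by blast
    then obtain \<Gamma> where \<Gamma>: "\<Gamma> \<subseteq> B" "\<alpha> = mv_join (X i) \<Gamma>"
      using i(2) unfolding mv_base_def by blast
    then have sub: "\<Gamma> \<subseteq> fuzzy_sets (X i)"
      using B(1) mv_topologyD(1)[OF T[OF i(1)]] unfolding mv_base_def by blast
    \<comment> \<open>As \<alpha> is a join of clopens of the factor, one of them already exceeds r
      at x i; here r \<ge> 0 rules out the disjunct \<open>r < 0\<close>. Its pullback is the clopen
      sought.\<close>
    have "r < mv_join (X i) \<Gamma> (x i)" using r(2) x by (simp add: i(3) \<Gamma>(2))
    then obtain b where b: "b \<in> \<Gamma>" "r < b (x i)"
      using less_mv_join_iff[OF sub Z[OF x i(1)]] r(1) by auto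
    then have "b \<in> T i" "mv_neg (X i) b \<in> T i"
      using B(2) \<Gamma>(1) mv_clopen_iff[OF mv_topologyD(1)[OF T[OF i(1)]]] by auto
    then have "mv_clopen Z \<tau> (\<lambda>x\<in>Z. b (x i))"
      using SI[OF i(1)] S\<tau> mv_neg_comp_projection[OF i(1), of X b]
      unfolding mv_clopen_iff[OF mv_topologyD(1)[OF top]] by (auto simp: Z_def)
    then show "\<exists>b. mv_clopen Z (mv_topology_generated_by Z S) b \<and> r < b x \<and> (\<forall>y\<in>Z. b y \<le> h y)"
      using b x mv_join_upper[OF sub Z[OF _ i(1)]]
      by (intro exI[of _ "\<lambda>x\<in>Z. b (x i)"]) (auto simp: \<tau> i(3) \<Gamma>(2))
  qed
  ultimately show ?thesis
    using top unfolding stone_mv_space_def Z_def \<tau>_def by blast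
qed

end
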